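(* Let $G=(V,E)$ be a graph on $n$ vertices whose adjacency matrix belongs to a homogeneous partially coherent algebra, and let $k\in[1,n]$ be a real number. Then $$\vartheta(G\,\square\,K_k)=\min\{k\,\vartheta(G),\,n\}=\vartheta_k(G).$$
   Context: Graphs are finite and simple with nonempty vertex set $V$; $A_G\in\mathbb{R}^{V\times V}$ is the adjacency matrix of $G$. $I$ is the identity matrix, $J$ the all-ones matrix, $\circ$ the entrywise (Schur) product, $\langle A,B\rangle=\operatorname{trace}(AB)$ for real symmetric $A,B$, and $A\preceq B$ means $B-A$ is positive semidefinite. A partially coherent algebra with respect to $I$ and $A_G$ is a subalgebra $\mathcal{A}_G$ of $\mathbb{R}^{V\times V}$ that contains $I$, $J$ and $A_G$, is self-adjoint (closed under transposition), and is closed under Schur product with $I$ and with $A_G$ (i.e. $M\in\mathcal{A}_G$ implies $I\circ M, A_G\circ M\in\mathcal{A}_G$). It is homogeneous if every matrix in it has constant diagonal. "The adjacency matrix of $G$ belongs to a homogeneous partially coherent algebra" means that such an algebra $\mathcal{A}_G$ with respect to $I$ and $A_G$ exists and is homogeneous. For real $k\in[1,n]$, $$\vartheta_k(G)=\max\{\langle J,X\rangle : X \text{ real symmetric } V\times V,\ \langle I,X\rangle=k,\ A_G\circ X=0,\ 0\preceq X\preceq I\},$$ and $\vartheta(G)=\vartheta_1(G)$ is the Lovász theta number. For real $k\in[1,n]$, $\vartheta(G\,\square\,K_k)$ denotes the maximum of $k\langle J,X\rangle+k(k-1)\langle J,Y\rangle$ over real symmetric $V\times V$ matrices $X,Y$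 with $X\succeq Y$, $X+(k-1)Y\succeq 0$, $A_G\circ X=0$, $I\circ Y=0$, and $k\langle I,X\rangle=1$. (For integer $k$ this is the Lovász theta number of the Cartesian product of $G$ with the complete graph $K_k$; for non-integer $k$ it is the definition of the notation.) *)

theory Defs
  imports "HOL-Analysis.Analysis"
begin

text \<open>
  A finite simple graph is a symmetric irreflexive relation on a finite type
  of vertices, which is nonempty like every type; its number of vertices is \<open>CARD('v)\<close>.
\<close>

definition simple_graph :: "('v::finite \<Rightarrow> 'v \<Rightarrow> bool) \<Rightarrow> bool" where
  "simple_graph E \<longleftrightarrow> symp E \<and> irreflp E"

definition adj_matrix :: "('v::finite \<Rightarrow> 'v \<Rightarrow> bool) \<Rightarrow> real^'v^'v" where
  "adj_matrix E = (\<chi> i j. if E i j then 1 else 0)"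

definition all_ones :: "real^'v^'v::finite" where
  "all_ones = (\<chi> i j. 1)"

definition schur :: "real^'v^'v \<Rightarrow> real^'v^'v \<Rightarrow> real^'v^'v::finite" where
  "schur A B = (\<chi> i j. A $ i $ j * B $ i $ j)"

definition minner :: "real^'v^'v \<Rightarrow> real^'v^'v \<Rightarrow> real" where
  "minner A B = trace (A ** B)"

definition psd :: "real^'v^'v::finite \<Rightarrow> bool" where
  "psd A \<longleftrightarrow> transpose A = A \<and> (\<forall>x. 0 \<le> x \<bullet> (A *v x))"

definition loewner_le :: "real^'v^'v \<Rightarrow> real^'v^'v::finite \<Rightarrow> bool" where
  "loewner_le A B \<longleftrightarrow> psd (B - A)"


definition partially_coherent_algebra ::
  "real^'v^'v \<Rightarrow> (real^'v^'v::finite) set \<Rightarrow> bool" where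
  "partially_coherent_algebra A \<A> \<longleftrightarrow>
     subspace \<A> \<and>
     (\<forall>M\<in>\<A>. \<forall>N\<in>\<A>. M ** N \<in> \<A>) \<and>
     mat 1 \<in> \<A> \<and> all_ones \<in> \<A> \<and> A \<in> \<A> \<and>
     (\<forall>M\<in>\<A>. transpose M \<in> \<A>) \<and>
     (\<forall>M\<in>\<A>. schur (mat 1) M \<in> \<A>) \<and>
     (\<forall>M\<in>\<A>. schur A M \<in> \<A>)"

definition homogeneous :: "(real^'v^'v::finite) set \<Rightarrow> bool" where
  "homogeneous \<A> \<longleftrightarrow> (\<forall>M\<in>\<A>. \<forall>i j. M $ i $ i = M $ j $ j)"


definition theta_k_feasible ::
  "('v::finite \<Rightarrow> 'v \<Rightarrow> bool) \<Rightarrow> real \<Rightarrow> (real^'v^'v) set" where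
  "theta_k_feasible E k =
     {X. transpose X = X \<and> minner (mat 1) X = k \<and> schur (adj_matrix E) X = 0 \<and>
         loewner_le 0 X \<and> loewner_le X (mat 1)}"

text \<open>
  The optima below are maxima: \<open>GREATEST\<close> denotes the largest attained value. Its existence is
  proved at the end of this theory for every \<open>k\<close> between 1 and the number of vertices.
\<close>

definition theta_k :: "('v::finite \<Rightarrow> 'v \<Rightarrow> bool) \<Rightarrow> real \<Rightarrow> real" where
  "theta_k E k = (GREATEST t. \<exists>X\<in>theta_k_feasible E k. t = minner all_ones X)"

definition theta :: "('v::finite \<Rightarrow> 'v \<Rightarrow> bool) \<Rightarrow> real" where
  "theta E = theta_k E 1"

text \<open>
  The theta number of the Cartesian product with the complete graph on \<open>k\<close> vertices, through the
  semidefinite program obtained by averaging over the permutations of those vertices: \<open>X\<close> is the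
  diagonal and \<open>Y\<close> the off-diagonal block. The program makes sense for real \<open>k\<close>, and this is what
  the notation means when \<open>k\<close> is not an integer.
\<close>

definition theta_cart_feasible ::
  "('v::finite \<Rightarrow> 'v \<Rightarrow> bool) \<Rightarrow> real \<Rightarrow> ((real^'v^'v) \<times> (real^'v^'v)) set" where
  "theta_cart_feasible E k =
     {(X, Y). transpose X = X \<and> transpose Y = Y \<and>
        loewner_le Y X \<and> loewner_le 0 (X + (k - 1) *\<^sub>R Y) \<and>
        schur (adj_matrix E) X = 0 \<and> schur (mat 1) Y = 0 \<and> k * minner (mat 1) X = 1}"

definition theta_cart_objective :: "real \<Rightarrow> real^'v^'v \<Rightarrow> real^'v^'v::finite \<Rightarrow> real" where
  "theta_cart_objective k X Y = k * minner all_ones X + k * (k - 1) * minner all_ones Y"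

definition theta_cart_complete :: "('v::finite \<Rightarrow> 'v \<Rightarrow> bool) \<Rightarrow> real \<Rightarrow> real" where
  "theta_cart_complete E k =
     (GREATEST t. \<exists>(X, Y)\<in>theta_cart_feasible E k. t = theta_cart_objective k X Y)"


lemma minner_mat1: "minner (mat 1) X = trace X"
  by (simp add: minner_def)

lemma continuous_on_entry [continuous_intros]:
  fixes f :: "'a::topological_space \<Rightarrow> real^'v^'v::finite"
  shows "continuous_on S f \<Longrightarrow> continuous_on S (\<lambda>x. f x $ i $ j)"
  by (intro continuous_on_component)

lemma continuous_on_quadform [continuous_intros]:
  fixes f :: "'a::topological_space \<Rightarrow> real^'v^'v::finite"
  shows "continuous_on S f \<Longrightarrow> continuous_on S (\<lambda>x. v \<bullet> (f x *v v))"
  unfolding inner_vec_def matrix_vector_mult_def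
  by (simp, intro continuous_intros)

lemma continuous_on_minner [continuous_intros]:
  fixes f :: "'a::topological_space \<Rightarrow> real^'v^'v::finite"
  shows "continuous_on S f \<Longrightarrow> continuous_on S (\<lambda>x. minner A (f x))"
  unfolding minner_def trace_def matrix_matrix_mult_def
  by (simp, intro continuous_intros)

lemma symmetric_iff: "transpose X = X \<longleftrightarrow> (\<forall>i j. X $ j $ i = X $ i $ j)"
  by (simp add: transpose_def vec_eq_iff)

lemma schur_eq_0_iff: "schur A X = 0 \<longleftrightarrow> (\<forall>i j. A $ i $ j * X $ i $ j = 0)"
  by (simp add: schur_def vec_eq_iff)

lemma psd_diag: "psd A \<Longrightarrow> 0 \<le> A $ i $ i"
  unfolding psd_def
  by (metis inner_axis' inner_real_def matrix_vector_mult_basis mult_1 column_def vec_lambda_beta)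

lemma psd_entry_le_trace:
  assumes "psd A" shows "\<bar>A $ i $ j\<bar> \<le> trace A"
proof -
  have q: "(axis i 1 + c *\<^sub>R axis j 1) \<bullet> (A *v (axis i 1 + c *\<^sub>R axis j 1)) =
    A $ i $ i + c * A $ i $ j + c * A $ j $ i + c * c * A $ j $ j" for c :: real
    by (simp add: matrix_vector_right_distrib matrix_vector_mult_scaleR inner_add_left
        inner_add_right matrix_vector_mult_basis column_def inner_axis' algebra_simps)
  have sym: "A $ j $ i = A $ i $ j" using assms by (simp add: psd_def symmetric_iff)
  have "0 \<le> A $ i $ i + c * A $ i $ j + c * A $ j $ i + c * c * A $ j $ j" for c :: real
    using assms q[of c] unfolding psd_def by metis
  from this[of 1] this[of "-1"] sym
  have *: "2 * \<bar>A $ i $ j\<bar> \<le> A $ i $ i + A $ j $ j" by auto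
  have "A $ l $ l \<le> trace A" for l
    unfolding trace_def by (rule member_le_sum) (auto intro: psd_diag assms)
  from this[of i] this[of j] * show ?thesis by linarith
qed

lemma norm_psd_le:
  fixes A :: "real^'v^'v::finite"
  assumes "psd A" shows "norm A \<le> real CARD('v) * (real CARD('v) * trace A)"
proof -
  have "norm (A $ i) \<le> real CARD('v) * trace A" for i
  proof -
    have "norm (A $ i) \<le> (\<Sum>j\<in>UNIV. \<bar>A $ i $ j\<bar>)" by (rule norm_le_l1_cart)
    also have "\<dots> \<le> real CARD('v) * trace A"
      by (rule sum_bounded_above) (rule psd_entry_le_trace[OF assms])
    finally show ?thesis .
  qed
  then have "(\<Sum>i\<in>UNIV. norm (A $ i)) \<le> real CARD('v) * (real CARD('v) * trace A)"
    by (intro sum_bounded_above)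
  moreover have "norm A \<le> (\<Sum>i\<in>UNIV. norm (A $ i))"
    unfolding norm_vec_def by (rule L2_set_le_sum) simp
  ultimately show ?thesis by linarith
qed

lemma psd_add: "psd A \<Longrightarrow> psd B \<Longrightarrow> psd (A + B)"
  by (auto simp: psd_def symmetric_iff matrix_vector_mult_add_rdistrib inner_add_right)

lemma psd_scaleR: "psd A \<Longrightarrow> 0 \<le> c \<Longrightarrow> psd (c *\<^sub>R A)"
  by (auto simp: psd_def symmetric_iff scaleR_matrix_vector_assoc[symmetric])

lemma psd_mat1: "psd (mat 1)"
  by (simp add: psd_def transpose_mat)

lemma Greatest_attained:
  fixes f :: "'a::topological_space \<Rightarrow> real"
  assumes "compact S" "S \<noteq> {}" "continuous_on S f"
  obtains x where "x \<in> S" "\<And>y. y \<in> S \<Longrightarrow> f y \<le> f x" "(GREATEST t. \<exists>y\<in>S. t = f y) = f x"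
proof -
  obtain x where x: "x \<in> S" "\<And>y. y \<in> S \<Longrightarrow> f y \<le> f x"
    using continuous_attains_sup[OF assms] by blast
  moreover have "(GREATEST t. \<exists>y\<in>S. t = f y) = f x"
    using x by (intro Greatest_equality) auto
  ultimately show ?thesis using that by blast
qed

lemma theta_k_attained:
  fixes E :: "'v::finite \<Rightarrow> 'v \<Rightarrow> bool"
  assumes "simple_graph E" "1 \<le> k" "k \<le> real CARD('v)"
  obtains X where "X \<in> theta_k_feasible E k" "theta_k E k = minner all_ones X"
    "\<And>X'. X' \<in> theta_k_feasible E k \<Longrightarrow> minner all_ones X' \<le> minner all_ones X"
proof -
  let ?S = "theta_k_feasible E k"
  have "closed ?S"
    unfolding theta_k_feasible_def loewner_le_def psd_def symmetric_iff schur_eq_0_iff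
    by (intro closed_Collect_conj closed_Collect_all closed_Collect_eq closed_Collect_le
        continuous_intros)
  moreover have "bounded ?S"
    unfolding bounded_iff
  proof (intro exI ballI)
    fix X assume "X \<in> ?S"
    then have "psd X" "trace X = k"
      by (simp_all add: theta_k_feasible_def loewner_le_def minner_mat1)
    then show "norm X \<le> real CARD('v) * (real CARD('v) * k)" using norm_psd_le[of X] by simp
  qed
  ultimately have "compact ?S" by (simp add: compact_eq_bounded_closed)
  moreover have "?S \<noteq> {}"
  proof -
    let ?c = "k / real CARD('v)"
    let ?X = "?c *\<^sub>R mat 1 :: real^'v^'v"
    have "psd ?X" using assms by (intro psd_scaleR psd_mat1) simp
    moreover have "psd (mat 1 - ?X)"
    proof -
      have "mat 1 - ?X = (1 - ?c) *\<^sub>R mat 1" by (simp add: scaleR_left_diff_distrib)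
      then show ?thesis using psd_scaleR[OF psd_mat1, of "1 - ?c"] assms(2,3) by simp
    qed
    moreover have "schur (adj_matrix E) ?X = 0"
      using assms(1) by (auto simp: schur_eq_0_iff adj_matrix_def mat_def simple_graph_def
          irreflp_def)
    moreover have "trace ?X = k" by (simp add: trace_def mat_def)
    ultimately have "?X \<in> ?S"
      by (simp add: theta_k_feasible_def loewner_le_def minner_mat1 psd_def)
    then show ?thesis by blast
  qed
  moreover have "continuous_on ?S (minner all_ones)" by (intro continuous_intros)
  ultimately obtain X where "X \<in> ?S" "\<And>Y. Y \<in> ?S \<Longrightarrow> minner all_ones Y \<le> minner all_ones X"
    "(GREATEST t. \<exists>Y\<in>?S. t = minner all_ones Y) = minner all_ones X"
    by (rule Greatest_attained) blast
  then show ?thesis using that unfolding theta_k_def by blast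
qed

lemma theta_cart_complete_attained:
  fixes E :: "'v::finite \<Rightarrow> 'v \<Rightarrow> bool"
  assumes "simple_graph E" "1 \<le> k"
  obtains X Y where "(X, Y) \<in> theta_cart_feasible E k"
    "theta_cart_complete E k = theta_cart_objective k X Y"
    "\<And>X' Y'. (X', Y') \<in> theta_cart_feasible E k \<Longrightarrow>
       theta_cart_objective k X' Y' \<le> theta_cart_objective k X Y"
proof -
  let ?S = "theta_cart_feasible E k"
  let ?f = "\<lambda>p. theta_cart_objective k (fst p) (snd p)"
  have k: "k > 0" using assms(2) by simp
  have "closed ?S"
    unfolding theta_cart_feasible_def loewner_le_def psd_def symmetric_iff schur_eq_0_iff
      case_prod_beta
    by (intro closed_Collect_conj closed_Collect_all closed_Collect_eq closed_Collect_le
        continuous_intros)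
  moreover have "bounded ?S"
  proof -
    let ?n = "real CARD('v)"
    let ?B = "?n * (?n * (1 / k))"
    have "norm p \<le> ?B + (?B + ?B)" if "p \<in> ?S" for p
    proof -
      obtain X Y where p: "p = (X, Y)" by fastforce
      have h: "psd (X - Y)" "psd (X + (k - 1) *\<^sub>R Y)" "schur (mat 1) Y = 0" "k * trace X = 1"
        using that unfolding p theta_cart_feasible_def loewner_le_def by (auto simp: minner_mat1)
      have "k *\<^sub>R X = (k - 1) *\<^sub>R (X - Y) + (X + (k - 1) *\<^sub>R Y)"
        by (simp add: algebra_simps)
      then have "psd (k *\<^sub>R X)" using h assms(2) by (simp add: psd_add psd_scaleR)
      then have "psd ((1 / k) *\<^sub>R (k *\<^sub>R X))" by (rule psd_scaleR) (use k in simp)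
      then have X: "psd X" using k by simp
      have tX: "trace X = 1 / k" using h(4) k by (simp add: field_simps)
      have "Y $ i $ i = 0" for i
      proof -
        have "mat 1 $ i $ i * Y $ i $ i = 0" using h(3) unfolding schur_eq_0_iff by blast
        then show ?thesis by (simp add: mat_def)
      qed
      then have tXY: "trace (X - Y) = 1 / k" using tX by (simp add: trace_def)
      have 1: "norm X \<le> ?B" using norm_psd_le[OF X] tX by simp
      have 2: "norm (X - Y) \<le> ?B" using norm_psd_le[OF h(1)] tXY by simp
      have 3: "norm Y \<le> norm X + norm (X - Y)" by (metis norm_triangle_sub norm_minus_commute)
      have "norm p \<le> norm X + norm Y" unfolding p by (rule norm_Pair_le)
      then show ?thesis using 1 2 3 by linarith
    qed
    then show ?thesis unfolding bounded_iff by blast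
  qed
  ultimately have "compact ?S" by (simp add: compact_eq_bounded_closed)
  moreover have "?S \<noteq> {}"
  proof -
    let ?c = "1 / (k * real CARD('v))"
    let ?X = "?c *\<^sub>R mat 1 :: real^'v^'v"
    have "psd ?X" using k by (intro psd_scaleR psd_mat1) simp
    moreover have "schur (adj_matrix E) ?X = 0"
      using assms(1) by (auto simp: schur_eq_0_iff adj_matrix_def mat_def simple_graph_def
          irreflp_def)
    moreover have "k * trace ?X = 1" using k by (simp add: trace_def mat_def)
    ultimately have "(?X, 0) \<in> ?S"
      by (simp add: theta_cart_feasible_def loewner_le_def minner_mat1 psd_def schur_eq_0_iff
          symmetric_iff)
    then show ?thesis by blast
  qed
  moreover have "continuous_on ?S ?f"
    unfolding theta_cart_objective_def by (intro continuous_intros)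
  ultimately obtain p where "p \<in> ?S" "\<And>q. q \<in> ?S \<Longrightarrow> ?f q \<le> ?f p"
    "(GREATEST t. \<exists>q\<in>?S. t = ?f q) = ?f p"
    by (rule Greatest_attained) blast
  then show ?thesis
    using that[of "fst p" "snd p"] unfolding theta_cart_complete_def case_prod_beta by force
qed

end

theory Submission
  imports Defs
begin

text \<open>
  Write \<open>J\<close> for the all-ones matrix, \<open>\<one>\<close> for the all-ones vector, \<open>n\<close> for the number of vertices,
  and \<open>\<theta>\<close> for the Lovasz number.

  Both parameters are at most \<open>min (k \<theta>) n\<close> for every graph. The bound \<open>n\<close> comes from \<open>J \<preceq> n I\<close>.
  The bound \<open>k \<theta>\<close> holds because a feasible \<open>X\<close>, scaled to trace one, competes in the program that
  defines \<open>\<theta>\<close>; in the program of the Cartesian product, \<open>Y \<preceq> X\<close> then controls the \<open>Y\<close> part of the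
  objective.

  For the converse, homogeneity provides one very regular optimal solution \<open>Z\<close> of the program for
  \<open>\<theta>\<close> (lemma \<open>homogeneous_theta_optimum\<close>): any optimal solution is projected orthogonally onto the
  algebra. Pairings with elements of the algebra, hence trace and objective, do not change. That the
  projection stays positive semidefinite is lemma \<open>psd_projection_onto_algebra\<close>. As \<open>Z\<close> and \<open>Z J\<close>
  lie in the algebra, the diagonal of \<open>Z\<close> is constantly \<open>1 / n\<close> and its row sums are constantly
  \<open>\<theta> / n\<close>. Consequently
  \<open>(\<theta> / n\<^sup>2) J \<preceq> Z \<preceq> (\<theta> / n) I\<close>,
  where the left half holds because \<open>\<one>\<close> is an eigenvector of the positive semidefinite \<open>Z\<close> for the
  eigenvalue \<open>\<theta> / n\<close> (lemma \<open>quadform_ge_ones_eigenvalue\<close>), and the right half is optimality of \<open>\<theta>\<close> applied to the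
  matrices \<open>Z \<circ> x x\<^sup>T\<close> (lemma \<open>quadform_le_theta\<close>).

  With these two inequalities explicit solutions attain the upper bound: \<open>a Z + b I\<close> for the
  \<open>k\<close>-th theta number, and the pair \<open>X = Z / k\<close>, \<open>Y = (c / k) (J / n - Z)\<close> for the Cartesian
  product, with scalars \<open>a\<close>, \<open>b\<close>, \<open>c\<close> that depend on whether \<open>k \<theta>\<close> exceeds \<open>n\<close>.
\<close>

section \<open>Quadratic forms and the trace inner product\<close>

lemma psdI:
  "transpose M = M \<Longrightarrow> (\<And>x. 0 \<le> x \<bullet> (M *v x)) \<Longrightarrow> psd M"
  by (simp add: psd_def)

lemma psd_symmetric: "psd M \<Longrightarrow> transpose M = M"
  by (simp add: psd_def)

lemma psd_quadform: "psd M \<Longrightarrow> 0 \<le> x \<bullet> (M *v x)"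
  by (simp add: psd_def)

lemma quadform_sum:
  fixes M :: "real^'v^'v::finite"
  shows "x \<bullet> (M *v x) = (\<Sum>i\<in>UNIV. \<Sum>j\<in>UNIV. M $ i $ j * x $ i * x $ j)"
  by (simp add: inner_vec_def matrix_vector_mult_def sum_distrib_left mult_ac)

lemma minner_all_ones:
  fixes M :: "real^'v^'v::finite"
  shows "minner all_ones M = 1 \<bullet> (M *v 1)"
  unfolding quadform_sum
  by (simp add: minner_def trace_def matrix_matrix_mult_def all_ones_def)
     (rule sum.swap)

lemma quadform_all_ones:
  fixes x :: "real^'v::finite"
  shows "x \<bullet> (all_ones *v x) = (x \<bullet> 1)\<^sup>2"
  unfolding quadform_sum
  by (simp add: all_ones_def inner_vec_def power2_eq_square sum_product)

lemma symmetric_all_ones: "transpose all_ones = all_ones"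
  by (simp add: symmetric_iff all_ones_def)

lemma ones_inner_self: "1 \<bullet> (1 :: real^'v::finite) = real CARD('v)"
  by (simp add: inner_vec_def)

lemma inner_matrix_vector_symmetric:
  fixes M :: "real^'v^'v::finite"
  assumes "transpose M = M"
  shows "x \<bullet> (M *v y) = y \<bullet> (M *v x)"
  by (metis assms dot_lmul_matrix inner_commute transpose_matrix_vector)

lemma inner_eq_trace:
  fixes M N :: "real^'v^'v::finite"
  shows "M \<bullet> N = trace (M ** transpose N)"
  by (simp add: inner_vec_def trace_def matrix_matrix_mult_def transpose_def)

lemma inner_transpose:
  fixes M N :: "real^'v^'v::finite"
  shows "transpose M \<bullet> N = M \<bullet> transpose N"
  unfolding inner_vec_def transpose_def by simp (rule sum.swap)

text \<open>
  Twice the quadratic form is bounded entry by entry: on the \<open>2 \<times> 2\<close> principal submatrix indexed by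
  \<open>i, j\<close>, evaluate the form at \<open>x\<^sub>j e\<^sub>i - x\<^sub>i e\<^sub>j\<close> and sum over all pairs.
\<close>

lemma psd_le_trace:
  fixes M :: "real^'v^'v::finite"
  assumes "psd M"
  shows "x \<bullet> (M *v x) \<le> trace M * (x \<bullet> x)"
proof -
  have sym: "M $ j $ i = M $ i $ j" for i j
    using psd_symmetric[OF assms] by (simp add: symmetric_iff)
  have "2 * (M $ i $ j * x $ i * x $ j)
      \<le> M $ i $ i * (x $ j * x $ j) + M $ j $ j * (x $ i * x $ i)" for i j
  proof -
    let ?w = "x $ j *\<^sub>R axis i 1 - x $ i *\<^sub>R axis j (1::real)"
    have "?w \<bullet> (M *v ?w) = M $ i $ i * (x $ j * x $ j) + M $ j $ j * (x $ i * x $ i)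
        - x $ i * x $ j * M $ i $ j - x $ i * x $ j * M $ j $ i"
      by (simp add: matrix_vector_mult_diff_distrib matrix_vector_mult_scaleR inner_diff_left
          inner_diff_right matrix_vector_mult_basis column_def inner_axis' algebra_simps)
    then show ?thesis using psd_quadform[OF assms, of ?w] sym[of i j] by (simp add: mult_ac)
  qed
  then have "(\<Sum>i\<in>UNIV. \<Sum>j\<in>UNIV. 2 * (M $ i $ j * x $ i * x $ j))
      \<le> (\<Sum>i\<in>UNIV. \<Sum>j\<in>UNIV. M $ i $ i * (x $ j * x $ j) + M $ j $ j * (x $ i * x $ i))"
    by (intro sum_mono)
  also have "\<dots> = 2 * (trace M * (x \<bullet> x))"
    by (simp add: sum.distrib trace_def inner_vec_def sum_product)
       (subst (2) sum.swap, simp)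
  finally show ?thesis unfolding quadform_sum by (simp add: sum_distrib_left[symmetric])
qed

lemma trace_scaleR: "trace (c *\<^sub>R (M :: real^'v^'v::finite)) = c * trace M"
  by (simp add: trace_def sum_distrib_left)

lemma minner_all_ones_le:
  fixes M :: "real^'v^'v::finite"
  assumes "psd M"
  shows "minner all_ones M \<le> real CARD('v) * trace M"
  using psd_le_trace[OF assms, of "1"]
  by (simp add: minner_all_ones ones_inner_self mult.commute)

lemma minner_all_ones_mono:
  assumes "loewner_le M N"
  shows "minner all_ones M \<le> minner all_ones N"
  using psd_quadform[OF assms[unfolded loewner_le_def], of "1"]
  by (simp add: minner_all_ones matrix_vector_mult_diff_rdistrib inner_diff_right)

lemma minner_scaleR: "minner M (c *\<^sub>R N) = c * minner M (N :: real^'v^'v::finite)"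
  by (simp add: minner_def trace_def matrix_matrix_mult_def sum_distrib_left mult_ac)

section \<open>Upper bounds valid for every graph\<close>

lemma theta_k_upper:
  fixes E :: "'v::finite \<Rightarrow> 'v \<Rightarrow> bool"
  assumes "simple_graph E" "1 \<le> k" "k \<le> real CARD('v)" "X \<in> theta_k_feasible E k"
  shows "minner all_ones X \<le> theta_k E k"
  using theta_k_attained[OF assms(1-3)] assms(4) by metis

text \<open>
  The program for \<open>\<theta>\<close> in homogeneous form. The constraint \<open>X \<preceq> I\<close> is automatic at trace one, since
  the largest eigenvalue of a positive semidefinite matrix is at most its trace.
\<close>

lemma minner_all_ones_le_theta:
  fixes E :: "'v::finite \<Rightarrow> 'v \<Rightarrow> bool"
  assumes E: "simple_graph E" and M: "psd M" and A: "schur (adj_matrix E) M = 0"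
  shows "minner all_ones M \<le> theta E * trace M"
proof (cases "trace M = 0")
  case True
  then have "M = 0" using norm_psd_le[OF M] by simp
  then show ?thesis by (simp add: minner_all_ones trace_def)
next
  case False
  have "trace M \<ge> 0" unfolding trace_def by (intro sum_nonneg psd_diag[OF M])
  with False have t: "trace M > 0" by simp
  let ?N = "(1 / trace M) *\<^sub>R M"
  have N: "psd ?N" using M t by (intro psd_scaleR) auto
  have tN: "trace ?N = 1" using t by (simp add: trace_scaleR)
  have "psd (mat 1 - ?N)"
  proof (rule psdI)
    show "transpose (mat 1 - ?N) = mat 1 - ?N"
      using psd_symmetric[OF N] by (auto simp: symmetric_iff mat_def)
    show "0 \<le> x \<bullet> ((mat 1 - ?N) *v x)" for x
      using psd_le_trace[OF N, of x]
      by (simp add: tN matrix_vector_mult_diff_rdistrib inner_diff_right del: trace_scaleR)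
  qed
  then have "?N \<in> theta_k_feasible E 1"
    using N tN A psd_symmetric[OF N]
    by (auto simp: theta_k_feasible_def loewner_le_def minner_mat1 schur_eq_0_iff)
  then have "minner all_ones ?N \<le> theta E"
    unfolding theta_def by (rule theta_k_upper[OF E, rotated 2]) auto
  then show ?thesis using t by (simp add: minner_scaleR field_simps)
qed


lemma theta_le_card:
  fixes E :: "'v::finite \<Rightarrow> 'v \<Rightarrow> bool"
  assumes "simple_graph E"
  shows "theta E \<le> real CARD('v)"
proof -
  obtain X where X: "X \<in> theta_k_feasible E 1" "theta E = minner all_ones X"
    using theta_k_attained[OF assms, of 1] by (auto simp: theta_def)
  then show ?thesis using minner_all_ones_le[of X]
    by (simp add: theta_k_feasible_def loewner_le_def minner_mat1)
qed

lemma theta_k_le: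
  fixes E :: "'v::finite \<Rightarrow> 'v \<Rightarrow> bool"
  assumes E: "simple_graph E" and k: "1 \<le> k" "k \<le> real CARD('v)"
  shows "theta_k E k \<le> min (k * theta E) (real CARD('v))"
proof -
  obtain X where X: "X \<in> theta_k_feasible E k" and opt: "theta_k E k = minner all_ones X"
    using theta_k_attained[OF E k] by metis
  then have "psd X" "trace X = k" "schur (adj_matrix E) X = 0" "loewner_le X (mat 1)"
    by (auto simp: theta_k_feasible_def loewner_le_def minner_mat1)
  then show ?thesis
    using minner_all_ones_le_theta[OF E, of X] minner_all_ones_mono[of X "mat 1"]
    by (simp add: opt minner_all_ones ones_inner_self mult.commute)
qed

lemma theta_cart_complete_le:
  fixes E :: "'v::finite \<Rightarrow> 'v \<Rightarrow> bool"
  assumes E: "simple_graph E" and k: "1 \<le> k"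
  shows "theta_cart_complete E k \<le> min (k * theta E) (real CARD('v))"
proof -
  obtain X Y where XY: "(X, Y) \<in> theta_cart_feasible E k"
    and opt: "theta_cart_complete E k = theta_cart_objective k X Y"
    using theta_cart_complete_attained[OF E k] by metis
  have le: "loewner_le Y X" and W: "psd (X + (k - 1) *\<^sub>R Y)"
    and AX: "schur (adj_matrix E) X = 0" and diag: "schur (mat 1) Y = 0" and trX: "k * trace X = 1"
    using XY by (auto simp: theta_cart_feasible_def loewner_le_def minner_mat1)
  have "k *\<^sub>R X = (k - 1) *\<^sub>R (X - Y) + (X + (k - 1) *\<^sub>R Y)" by (simp add: algebra_simps)
  then have "psd (k *\<^sub>R X)" using le W k by (simp add: loewner_le_def psd_add psd_scaleR)
  moreover have "schur (adj_matrix E) (k *\<^sub>R X) = 0" using AX by (auto simp: schur_eq_0_iff)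
  ultimately have "minner all_ones (k *\<^sub>R X) \<le> theta E * trace (k *\<^sub>R X)"
    by (rule minner_all_ones_le_theta[OF E])
  then have kX: "k * minner all_ones X \<le> theta E" by (simp add: minner_scaleR trace_scaleR trX)
  have "theta_cart_objective k X Y \<le> k * minner all_ones X + k * (k - 1) * minner all_ones X"
    unfolding theta_cart_objective_def
    using k minner_all_ones_mono[OF le] by (intro add_left_mono mult_left_mono) auto
  also have "\<dots> = k * (k * minner all_ones X)" by (simp add: algebra_simps)
  also have "\<dots> \<le> k * theta E" using kX k by simp
  finally have 1: "theta_cart_objective k X Y \<le> k * theta E" .
  have "trace Y = 0"
  proof -
    have "mat 1 $ i $ i * Y $ i $ i = 0" for i using diag unfolding schur_eq_0_iff by blast
    then show ?thesis by (simp add: trace_def mat_def)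
  qed
  then have "k * trace (X + (k - 1) *\<^sub>R Y) = 1"
    using trX by (simp add: trace_add trace_scaleR)
  moreover have "theta_cart_objective k X Y = k * minner all_ones (X + (k - 1) *\<^sub>R Y)"
    by (simp add: theta_cart_objective_def minner_all_ones matrix_vector_mult_add_rdistrib
        scaleR_matrix_vector_assoc[symmetric] inner_add_right algebra_simps)
  moreover have "k * minner all_ones (X + (k - 1) *\<^sub>R Y)
      \<le> k * (real CARD('v) * trace (X + (k - 1) *\<^sub>R Y))"
    using k by (intro mult_left_mono minner_all_ones_le[OF W]) simp
  ultimately have 2: "theta_cart_objective k X Y \<le> real CARD('v)"
    by (metis mult.left_commute mult.right_neutral)
  show ?thesis using 1 2 opt by simp
qed

section \<open>Positive semidefiniteness under projection onto a matrix algebra\<close>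

text \<open>
  The form is minimal at \<open>v\<close>, so its gradient vanishes there. Concretely, the step \<open>t\<close> in direction
  \<open>M v\<close> is chosen so that the form would become negative if \<open>M v\<close> were nonzero.
\<close>

lemma psd_null_vector:
  fixes M :: "real^'v^'v::finite"
  assumes M: "psd M" and v: "v \<bullet> (M *v v) = 0"
  shows "M *v v = 0"
proof -
  let ?w = "M *v v"
  define a where "a = ?w \<bullet> ?w"
  define b where "b = ?w \<bullet> (M *v ?w)"
  have b: "b \<ge> 0" unfolding b_def by (rule psd_quadform[OF M])
  define t where "t = - a / (b + 1)"
  have "v \<bullet> (M *v ?w) = a"
    unfolding a_def by (rule inner_matrix_vector_symmetric[OF psd_symmetric[OF M]])
  then have "(v + t *\<^sub>R ?w) \<bullet> (M *v (v + t *\<^sub>R ?w)) = 2 * t * a + t\<^sup>2 * b"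
    using v by (simp add: matrix_vector_right_distrib matrix_vector_mult_scaleR inner_add_left
        inner_add_right a_def b_def power2_eq_square algebra_simps)
  then have "0 \<le> 2 * t * a + t\<^sup>2 * b" using psd_quadform[OF M, of "v + t *\<^sub>R ?w"] by simp
  also have "2 * t * a + t\<^sup>2 * b = - (a\<^sup>2 * (b + 2)) / (b + 1)\<^sup>2"
    using b unfolding t_def by (simp add: divide_simps power2_eq_square) (simp add: algebra_simps)
  finally have "a\<^sup>2 * (b + 2) / (b + 1)\<^sup>2 \<le> 0" by simp
  then have "a\<^sup>2 * (b + 2) \<le> 0" using b by (simp add: divide_le_0_iff)
  then have "a = 0" using b by (simp add: mult_le_0_iff)
  then show ?thesis by (simp add: a_def)
qed

text \<open>
  Rayleigh's principle: a minimizer \<open>v\<close> of the form on the unit sphere, with minimum \<open>l\<close>, is a null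
  vector of the positive semidefinite matrix \<open>M - l I\<close>.
\<close>

lemma not_psd_negative_eigenvector:
  fixes M :: "real^'v^'v::finite"
  assumes sym: "transpose M = M" and "\<not> psd M"
  obtains v l where "v \<noteq> 0" "l < 0" "M *v v = l *\<^sub>R v"
proof -
  obtain w where w: "w \<bullet> (M *v w) < 0" using assms by (auto simp: psd_def not_le)
  then have w0: "w \<noteq> 0" by auto
  have scale: "(c *\<^sub>R x) \<bullet> (M *v (c *\<^sub>R x)) = c\<^sup>2 * (x \<bullet> (M *v x))" for c x
    by (simp add: matrix_vector_mult_scaleR power2_eq_square)
  have "continuous_on (sphere 0 1) (\<lambda>x. x \<bullet> (M *v x))"
    by (intro continuous_intros linear_continuous_on matrix_vector_mul_bounded_linear)
  moreover have "w /\<^sub>R norm w \<in> sphere 0 1" using w0 by simp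
  ultimately obtain v where v: "v \<in> sphere 0 1"
    and min: "\<And>x. x \<in> sphere 0 1 \<Longrightarrow> v \<bullet> (M *v v) \<le> x \<bullet> (M *v x)"
    using continuous_attains_inf[of "sphere 0 1" "\<lambda>x. x \<bullet> (M *v x)"]
    by (metis compact_sphere empty_iff)
  define l where "l = v \<bullet> (M *v v)"
  have ray: "l * (x \<bullet> x) \<le> x \<bullet> (M *v x)" for x
  proof (cases "x = 0")
    case False
    then have "l \<le> (inverse (norm x) *\<^sub>R x) \<bullet> (M *v (inverse (norm x) *\<^sub>R x))"
      unfolding l_def by (intro min) simp
    then show ?thesis using False unfolding scale
      by (simp add: field_simps power2_norm_eq_inner[symmetric])
  qed simp
  have quad: "x \<bullet> ((M - l *\<^sub>R mat 1) *v x) = x \<bullet> (M *v x) - l * (x \<bullet> x)" for x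
    by (simp add: matrix_vector_mult_diff_rdistrib inner_diff_right
        scaleR_matrix_vector_assoc[symmetric])
  have "psd (M - l *\<^sub>R mat 1)"
  proof (rule psdI)
    show "transpose (M - l *\<^sub>R mat 1) = M - l *\<^sub>R mat 1"
      using sym by (auto simp: symmetric_iff mat_def)
    show "0 \<le> x \<bullet> ((M - l *\<^sub>R mat 1) *v x)" for x using ray[of x] by (simp add: quad)
  qed
  moreover have "v \<bullet> v = 1" using v by (simp add: norm_eq_1)
  moreover from \<open>v \<bullet> v = 1\<close> have "v \<bullet> ((M - l *\<^sub>R mat 1) *v v) = 0"
    unfolding quad by (simp add: l_def)
  ultimately have "(M - l *\<^sub>R mat 1) *v v = 0" by (intro psd_null_vector)
  then have "M *v v = l *\<^sub>R v"
    by (simp add: matrix_vector_mult_diff_rdistrib scaleR_matrix_vector_assoc[symmetric])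
  moreover have "l < 0"
  proof -
    have "l * (w \<bullet> w) < 0" using ray[of w] w by linarith
    moreover have "w \<bullet> w > 0" using w0 by simp
    ultimately show ?thesis by (simp add: mult_less_0_iff)
  qed
  moreover have "v \<noteq> 0" using v by auto
  ultimately show ?thesis using that by blast
qed

lemma matrix_mult_scaleR_right: "(A :: real^'v^'v::finite) ** (c *\<^sub>R B) = c *\<^sub>R (A ** B)"
  by (simp add: vec_eq_iff matrix_matrix_mult_def sum_distrib_left algebra_simps)

lemma matrix_mult_scaleR_left: "(c *\<^sub>R A :: real^'v^'v::finite) ** B = c *\<^sub>R (A ** B)"
  by (simp add: vec_eq_iff matrix_matrix_mult_def sum_distrib_left algebra_simps)

text \<open>
  This replaces the spectral projection of \<open>Y\<close> for the eigenvalue \<open>l\<close>. Multiplication by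
  \<open>Y - l I\<close> is a linear endomorphism of the algebra. If it were injective, it would be surjective by
  finite dimension, so \<open>Y - l I\<close> would have an inverse in the algebra, although it annihilates \<open>v\<close>.
\<close>

lemma eigenvalue_realized_in_algebra:
  fixes \<A> :: "(real^'v^'v::finite) set"
  assumes sub: "subspace \<A>" and mult: "\<And>M N. M \<in> \<A> \<Longrightarrow> N \<in> \<A> \<Longrightarrow> M ** N \<in> \<A>"
    and one: "mat 1 \<in> \<A>" and Y: "Y \<in> \<A>" "transpose Y = Y"
    and v: "v \<noteq> 0" "Y *v v = l *\<^sub>R v"
  obtains M where "M \<in> \<A>" "M \<noteq> 0" "Y ** M = l *\<^sub>R M"
proof -
  define f where "f M = Y ** M - l *\<^sub>R M" for M :: "real^'v^'v"
  have f: "linear f"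
    by (rule linearI) (simp_all add: f_def matrix_add_ldistrib matrix_mult_scaleR_right algebra_simps)
  have "\<exists>M\<in>\<A>. M \<noteq> 0 \<and> f M = 0"
  proof (rule ccontr)
    assume "\<not> (\<exists>M\<in>\<A>. M \<noteq> 0 \<and> f M = 0)"
    then have "inj_on f (span \<A>)"
      using sub f by (simp add: linear_injective_on_subspace_0 span_eq_iff[THEN iffD2]) blast
    then have "dim (f ` \<A>) = dim \<A>" by (rule dim_image_eq[OF f])
    moreover have "f ` \<A> \<subseteq> \<A>"
      using sub mult Y(1) by (auto simp: f_def intro!: subspace_diff subspace_scale)
    ultimately have "f ` \<A> = \<A>"
      using linear_subspace_image[OF f sub] sub by (intro subspace_dim_equal) auto
    then obtain M where "f M = mat 1" using one by (metis imageE)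
    then have "transpose (f M) *v v = v" by (simp add: transpose_mat)
    moreover have "transpose (f M) = transpose M ** Y - l *\<^sub>R transpose M"
    proof -
      have "transpose (f M) = transpose (Y ** M) - l *\<^sub>R transpose M"
        by (simp add: f_def transpose_def vec_eq_iff)
      then show ?thesis by (simp add: matrix_transpose_mul Y(2))
    qed
    moreover have "(transpose M ** Y - l *\<^sub>R transpose M) *v v = 0"
      by (simp add: matrix_vector_mult_diff_rdistrib scaleR_matrix_vector_assoc[symmetric] v(2)
          matrix_vector_mul_assoc[symmetric] matrix_vector_mult_scaleR)
    ultimately show False using v(1) by simp
  qed
  then show ?thesis using that by (auto simp: f_def)
qed

lemma psd_congruence:
  fixes X M :: "real^'v^'v::finite"
  assumes "psd X"
  shows "psd (transpose M ** X ** M)"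
proof (rule psdI)
  show "transpose (transpose M ** X ** M) = transpose M ** X ** M"
    using psd_symmetric[OF assms] by (simp add: matrix_transpose_mul matrix_mul_assoc)
  fix x
  have "x \<bullet> ((transpose M ** X ** M) *v x) = (M *v x) \<bullet> (X *v (M *v x))"
    by (metis dot_lmul_matrix matrix_vector_mul_assoc transpose_matrix_vector vector_transpose_matrix transpose_transpose)
  then show "0 \<le> x \<bullet> ((transpose M ** X ** M) *v x)" using psd_quadform[OF assms] by simp
qed

text \<open>
  The projection \<open>Y\<close> is symmetric because the algebra is closed under transposition. If \<open>Y\<close> had a
  negative eigenvalue \<open>l\<close>, there would be a nonzero \<open>M\<close> in the algebra with \<open>Y M = l M\<close>. As
  \<open>M M\<^sup>T\<close> lies in the algebra, it pairs equally with \<open>X\<close> and \<open>Y\<close>; but the pairing with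
  \<open>X\<close> is \<open>trace (M\<^sup>T X M) \<ge> 0\<close>, and the pairing with \<open>Y\<close> is \<open>l \<parallel>M\<parallel>\<^sup>2 < 0\<close>.
\<close>

lemma psd_projection_onto_algebra:
  fixes \<A> :: "(real^'v^'v::finite) set"
  assumes sub: "subspace \<A>" and mult: "\<And>M N. M \<in> \<A> \<Longrightarrow> N \<in> \<A> \<Longrightarrow> M ** N \<in> \<A>"
    and tr: "\<And>M. M \<in> \<A> \<Longrightarrow> transpose M \<in> \<A>" and one: "mat 1 \<in> \<A>" and X: "psd X"
  obtains Y where "Y \<in> \<A>" "psd Y" "\<And>N. N \<in> \<A> \<Longrightarrow> Y \<bullet> N = X \<bullet> N"
proof -
  obtain Y Z where Y: "Y \<in> span \<A>" and Z: "\<And>N. N \<in> span \<A> \<Longrightarrow> orthogonal Z N" and XYZ: "X = Y + Z"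
    using orthogonal_subspace_decomp_exists[of \<A> X] by metis
  have Y: "Y \<in> \<A>" using Y sub by (simp add: span_eq_iff[THEN iffD2])
  have proj: "Y \<bullet> N = X \<bullet> N" if "N \<in> \<A>" for N
    using Z[OF span_base[OF that]] by (simp add: XYZ orthogonal_def inner_add_left)
  have sym: "transpose Y = Y"
  proof -
    let ?D = "transpose Y - Y"
    have D: "?D \<in> \<A>" using sub tr Y by (intro subspace_diff) auto
    have "transpose Y \<bullet> ?D = X \<bullet> transpose ?D"
      unfolding inner_transpose by (rule proj[OF tr[OF D]])
    also have "\<dots> = X \<bullet> ?D"
      by (metis X inner_transpose psd_symmetric)
    also have "\<dots> = Y \<bullet> ?D" by (rule proj[OF D, symmetric])
    finally have "?D \<bullet> ?D = 0" by (simp only: inner_diff_left)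
    then show ?thesis by simp
  qed
  have "psd Y"
  proof (rule ccontr)
    assume "\<not> psd Y"
    then obtain v l where v: "v \<noteq> 0" "l < 0" "Y *v v = l *\<^sub>R v"
      using not_psd_negative_eigenvector[OF sym] by metis
    obtain M where M: "M \<in> \<A>" "M \<noteq> 0" "Y ** M = l *\<^sub>R M"
      using eigenvalue_realized_in_algebra[OF sub mult one Y sym v(1,3)] by metis
    have pair: "W \<bullet> (M ** transpose M) = trace (W ** M ** transpose M)" for W
      by (simp add: inner_eq_trace matrix_transpose_mul matrix_mul_assoc)
    have "X \<bullet> (M ** transpose M) = trace (transpose M ** X ** M)"
      unfolding pair by (metis matrix_mul_assoc trace_mul_sym)
    moreover have "trace (transpose M ** X ** M) \<ge> 0"
      unfolding trace_def by (intro sum_nonneg psd_diag psd_congruence X)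
    moreover have "Y \<bullet> (M ** transpose M) = l * (M \<bullet> M)"
      unfolding pair M(3) by (simp add: matrix_mult_scaleR_left trace_scaleR inner_eq_trace)
    moreover have "l * (M \<bullet> M) < 0" using v(2) M(2) by (simp add: mult_less_0_iff)
    ultimately show False using proj[OF mult[OF M(1) tr[OF M(1)]]] by simp
  qed
  with Y proj that show ?thesis by blast
qed

section \<open>A regular optimal solution in the homogeneous case\<close>

text \<open>
  The solution is the projection onto \<open>\<A>\<close> of any optimal one. Pairing with \<open>I\<close> and \<open>J\<close>
  preserves trace and objective; homogeneity applied to \<open>Z\<close> and to \<open>Z J\<close>, whose diagonal lists the
  row sums of \<open>Z\<close>, makes diagonal and row sums constant.
\<close>

lemma homogeneous_theta_optimum:
  fixes E :: "'v::finite \<Rightarrow> 'v \<Rightarrow> bool"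
  assumes E: "simple_graph E"
    and pca: "partially_coherent_algebra (adj_matrix E) \<A>" and hom: "homogeneous \<A>"
  obtains Z where "psd Z" "schur (adj_matrix E) Z = 0"
    "\<And>i. Z $ i $ i = 1 / real CARD('v)" "Z *v 1 = (theta E / real CARD('v)) *\<^sub>R 1"
proof -
  let ?n = "real CARD('v)"
  have sub: "subspace \<A>" and mult: "\<And>M N. M \<in> \<A> \<Longrightarrow> N \<in> \<A> \<Longrightarrow> M ** N \<in> \<A>"
    and one: "mat 1 \<in> \<A>" and J: "all_ones \<in> \<A>"
    and tr: "\<And>M. M \<in> \<A> \<Longrightarrow> transpose M \<in> \<A>"
    and schurA: "\<And>M. M \<in> \<A> \<Longrightarrow> schur (adj_matrix E) M \<in> \<A>"
    using pca by (auto simp: partially_coherent_algebra_def)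
  obtain X where X: "X \<in> theta_k_feasible E 1" "theta E = minner all_ones X"
    using theta_k_attained[OF E, of 1] by (auto simp: theta_def)
  have psdX: "psd X" and trX: "trace X = 1" and AX: "schur (adj_matrix E) X = 0"
    using X(1) by (auto simp: theta_k_feasible_def loewner_le_def minner_mat1)
  obtain Z where Z: "Z \<in> \<A>" "psd Z" and proj: "\<And>N. N \<in> \<A> \<Longrightarrow> Z \<bullet> N = X \<bullet> N"
    using psd_projection_onto_algebra[OF sub mult tr one psdX] by metis
  \<comment> \<open>Schur multiplication by the 0/1 matrix of the graph is an orthogonal projection that maps the
     algebra into itself, so \<open>A \<circ> Z\<close> pairs with itself as \<open>X\<close> pairs with it, and that is zero.\<close>
  have AZ: "schur (adj_matrix E) Z = 0"
  proof -
    let ?S = "schur (adj_matrix E) Z"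
    have move: "schur (adj_matrix E) W \<bullet> ?S = W \<bullet> ?S" for W
      by (simp add: schur_def inner_vec_def adj_matrix_def if_distrib cong: if_cong)
         (intro sum.cong refl, auto)
    have "?S \<bullet> ?S = 0" using move[of Z] move[of X] proj[OF schurA[OF Z(1)]] AX by simp
    then show ?thesis by simp
  qed
  have trZ: "trace Z = 1"
    using proj[OF one] trX by (simp add: inner_eq_trace transpose_mat)
  have diag: "Z $ i $ i = 1 / ?n" for i
  proof -
    have "Z $ j $ j = Z $ i $ i" for j using hom Z(1) by (simp add: homogeneous_def)
    then have "trace Z = (\<Sum>j\<in>(UNIV :: 'v set). Z $ i $ i)"
      unfolding trace_def by (intro sum.cong) auto
    then have "trace Z = ?n * Z $ i $ i" by simp
    then show ?thesis using trZ by (simp add: field_simps)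
  qed
  have JZ: "1 \<bullet> (Z *v 1) = theta E"
  proof -
    have "minner all_ones W = W \<bullet> all_ones" for W :: "real^'v^'v"
      by (metis inner_eq_trace minner_def symmetric_all_ones trace_mul_sym)
    then show ?thesis using proj[OF J] X(2) by (metis minner_all_ones)
  qed
  have row: "(Z *v 1) $ i = theta E / ?n" for i
  proof -
    have "(Z *v 1) $ j = (Z ** all_ones) $ j $ j" for j
      by (simp add: matrix_vector_mult_def matrix_matrix_mult_def all_ones_def)
    then have "(Z *v 1) $ j = (Z *v 1) $ i" for j
      using hom mult[OF Z(1) J] by (metis homogeneous_def)
    then have "(\<Sum>j\<in>UNIV. (Z *v 1) $ j) = (\<Sum>j\<in>(UNIV :: 'v set). (Z *v 1) $ i)"
      by (intro sum.cong) auto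
    then have "1 \<bullet> (Z *v 1) = ?n * (Z *v 1) $ i" by (simp add: inner_vec_def)
    then show ?thesis using JZ by (simp add: field_simps)
  qed
  then have "Z *v 1 = (theta E / ?n) *\<^sub>R 1" by (simp add: vec_eq_iff)
  with Z(2) AZ diag that show ?thesis by blast
qed

text \<open>
  For constant diagonal, \<open>\<theta>\<close> also bounds the largest eigenvalue. The matrix
  \<open>W = Z \<circ> x x\<^sup>T\<close> is positive semidefinite and vanishes on the edges, its trace is \<open>d \<parallel>x\<parallel>\<^sup>2\<close>,
  and its entries sum to the quadratic form of \<open>Z\<close> at \<open>x\<close>.
\<close>

lemma quadform_le_theta:
  fixes E :: "'v::finite \<Rightarrow> 'v \<Rightarrow> bool"
  assumes E: "simple_graph E" and Z: "psd Z" and AZ: "schur (adj_matrix E) Z = 0"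
    and diag: "\<And>i. Z $ i $ i = d"
  shows "x \<bullet> (Z *v x) \<le> theta E * d * (x \<bullet> x)"
proof -
  define W :: "real^'v^'v" where "W = (\<chi> i j. Z $ i $ j * x $ i * x $ j)"
  have "psd W"
  proof (rule psdI)
    show "transpose W = W" using psd_symmetric[OF Z] by (simp add: symmetric_iff W_def mult_ac)
    have "y \<bullet> (W *v y) = (\<chi> i. x $ i * y $ i) \<bullet> (Z *v (\<chi> i. x $ i * y $ i))" for y
      unfolding quadform_sum by (simp add: W_def mult_ac)
    then show "0 \<le> y \<bullet> (W *v y)" for y using psd_quadform[OF Z] by simp
  qed
  moreover have "schur (adj_matrix E) W = 0" using AZ by (auto simp: schur_eq_0_iff W_def)
  ultimately have "minner all_ones W \<le> theta E * trace W"
    by (rule minner_all_ones_le_theta[OF E])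
  moreover have "minner all_ones W = x \<bullet> (Z *v x)"
    unfolding minner_all_ones quadform_sum by (simp add: W_def)
  moreover have "trace W = d * (x \<bullet> x)"
    by (simp add: trace_def W_def diag inner_vec_def sum_distrib_left mult_ac)
  ultimately show ?thesis by simp
qed

text \<open>
  The line spanned by \<open>\<one>\<close> is invariant and splits off orthogonally: subtracting from \<open>x\<close> its component \<open>t \<one>\<close> along
  \<open>\<one>\<close> removes exactly the left-hand side from the form.
\<close>

lemma quadform_ge_ones_eigenvalue:
  fixes Z :: "real^'v^'v::finite"
  assumes Z: "psd Z" and eig: "Z *v 1 = c *\<^sub>R 1"
  shows "c * (x \<bullet> 1)\<^sup>2 / real CARD('v) \<le> x \<bullet> (Z *v x)"
proof -
  let ?n = "real CARD('v)"
  define t where "t = (x \<bullet> 1) / ?n"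
  have "1 \<bullet> (Z *v x) = c * (x \<bullet> 1)"
    using inner_matrix_vector_symmetric[OF psd_symmetric[OF Z], of 1 x] eig by simp
  then have "(x - t *\<^sub>R 1) \<bullet> (Z *v (x - t *\<^sub>R 1)) = x \<bullet> (Z *v x) - 2 * t * c * (x \<bullet> 1) + t\<^sup>2 * c * ?n"
    by (simp add: matrix_vector_mult_diff_distrib matrix_vector_mult_scaleR inner_diff_left
        inner_diff_right eig ones_inner_self power2_eq_square algebra_simps)
  also have "\<dots> = x \<bullet> (Z *v x) - c * (x \<bullet> 1)\<^sup>2 / ?n"
    unfolding t_def by (simp add: divide_simps power2_eq_square)
  finally show ?thesis using psd_quadform[OF Z, of "x - t *\<^sub>R 1"] by simp
qed


section \<open>Explicit solutions that attain the bounds\<close>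

text \<open>
  If \<open>k \<theta> \<le> n\<close>, the matrix \<open>k Z\<close> is feasible because \<open>k Z \<preceq> (k \<theta> / n) I \<preceq> I\<close>.
  Otherwise the eigenvalue of \<open>k Z\<close> at \<open>\<one>\<close> exceeds one; part of the trace is moved from \<open>Z\<close> to \<open>I / n\<close> until the
  eigenvalue of \<open>\<one>\<close>, which is the largest one, equals one.
\<close>

lemma theta_k_ge:
  fixes E :: "'v::finite \<Rightarrow> 'v \<Rightarrow> bool"
  assumes E: "simple_graph E" and k: "1 \<le> k" "k \<le> real CARD('v)"
    and Z: "psd Z" "schur (adj_matrix E) Z = 0" "\<And>i. Z $ i $ i = 1 / real CARD('v)"
    and eig: "Z *v 1 = (theta E / real CARD('v)) *\<^sub>R 1"
  shows "min (k * theta E) (real CARD('v)) \<le> theta_k E k"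
proof -
  let ?n = "real CARD('v)" and ?\<theta> = "theta E"
  have n: "?n > 0" by simp
  obtain a b where a: "a \<ge> 0" and b: "b \<ge> 0" and tr: "a + b * ?n = k"
    and obj: "a * ?\<theta> + b * ?n = min (k * ?\<theta>) ?n"
  proof (cases "k * ?\<theta> \<le> ?n")
    case True
    then show ?thesis using that[of k 0] k by simp
  next
    case False
    have \<theta>: "?\<theta> > 1"
    proof (rule ccontr)
      assume "\<not> ?\<theta> > 1"
      then have "k * ?\<theta> \<le> k * 1" using k by (intro mult_left_mono) auto
      then show False using False k by linarith
    qed
    \<comment> \<open>solves \<open>a + b n = k\<close> (trace) and \<open>a \<theta> + b n = n\<close> (eigenvalue one at \<open>\<one>\<close>)\<close>
    define a where "a = (?n - k) / (?\<theta> - 1)"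
    have a\<theta>: "a * (?\<theta> - 1) = ?n - k" using \<theta> by (simp add: a_def)
    have "a \<ge> 0" using \<theta> k by (simp add: a_def)
    moreover have "a \<le> k" using \<theta> False by (simp add: a_def field_simps)
    moreover have "a * ?\<theta> + (k - a) = ?n" using a\<theta> by (simp add: algebra_simps)
    ultimately show ?thesis using that[of a "(k - a) / ?n"] False n by simp
  qed
  let ?X = "a *\<^sub>R Z + b *\<^sub>R mat 1"
  have quad: "x \<bullet> (?X *v x) = a * (x \<bullet> (Z *v x)) + b * (x \<bullet> x)" for x
    by (simp add: matrix_vector_mult_add_rdistrib scaleR_matrix_vector_assoc[symmetric]
        inner_add_right)
  have psdX: "psd ?X" using a b Z(1) by (intro psd_add psd_scaleR psd_mat1)
  have "psd (mat 1 - ?X)"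
  proof (rule psdI)
    show "transpose (mat 1 - ?X) = mat 1 - ?X"
      using psd_symmetric[OF Z(1)] by (auto simp: symmetric_iff mat_def)
    fix x
    have "x \<bullet> (Z *v x) \<le> ?\<theta> * (1 / ?n) * (x \<bullet> x)" by (rule quadform_le_theta[OF E Z])
    then have "x \<bullet> (?X *v x) \<le> a * (?\<theta> * (1 / ?n) * (x \<bullet> x)) + b * (x \<bullet> x)"
      unfolding quad using a by (intro add_right_mono mult_left_mono)
    also have "\<dots> = (a * ?\<theta> + b * ?n) / ?n * (x \<bullet> x)" using n by (simp add: field_simps)
    also have "\<dots> \<le> 1 * (x \<bullet> x)" unfolding obj using n by (intro mult_right_mono) auto
    finally show "0 \<le> x \<bullet> ((mat 1 - ?X) *v x)"
      by (simp add: matrix_vector_mult_diff_rdistrib inner_diff_right)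
  qed
  moreover have "schur (adj_matrix E) ?X = 0"
    using Z(2) E
    by (auto simp: schur_eq_0_iff adj_matrix_def mat_def simple_graph_def irreflp_def split: if_splits)
  moreover have "trace ?X = k"
    using tr by (simp add: trace_def mat_def Z(3) distrib_left mult.commute)
  ultimately have "?X \<in> theta_k_feasible E k"
    using psdX psd_symmetric[OF psdX] by (simp add: theta_k_feasible_def loewner_le_def minner_mat1)
  then have "minner all_ones ?X \<le> theta_k E k" by (rule theta_k_upper[OF E k])
  moreover have "minner all_ones ?X = a * ?\<theta> + b * ?n"
    unfolding minner_all_ones quad using n by (simp add: eig ones_inner_self)
  ultimately show ?thesis using obj by simp
qed

text \<open>
  With \<open>X = Z / k\<close> and \<open>Y = (c / k) (J / n - Z)\<close>, the diagonal of \<open>Y\<close> vanishes, and the objective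
  \<open>\<theta> + (k - 1) c (n - \<theta>)\<close> does not decrease with \<open>c\<close>. On \<open>\<one>\<close> the constraint \<open>X \<succeq> Y\<close> reads
  \<open>c (n - \<theta>) \<le> \<theta>\<close>, and the lower bound on \<open>Z\<close> shows that this suffices. The constraint
  \<open>X + (k - 1) Y \<succeq> 0\<close> holds once \<open>(k - 1) c \<le> 1\<close>, as the left-hand side is then a nonnegative
  combination of \<open>Z\<close> and \<open>J\<close>. Unless \<open>k = 1\<close> and \<open>\<theta> = n\<close>, there is a largest \<open>c\<close> that satisfies
  both inequalities; it turns the objective into \<open>k \<theta>\<close> or \<open>n\<close>, according to which of them is tight.
\<close>

lemma theta_cart_complete_ge:
  fixes E :: "'v::finite \<Rightarrow> 'v \<Rightarrow> bool"
  assumes E: "simple_graph E" and k: "1 \<le> k"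
    and Z: "psd Z" "schur (adj_matrix E) Z = 0" "\<And>i. Z $ i $ i = 1 / real CARD('v)"
    and eig: "Z *v 1 = (theta E / real CARD('v)) *\<^sub>R 1"
  shows "min (k * theta E) (real CARD('v)) \<le> theta_cart_complete E k"
proof -
  let ?n = "real CARD('v)" and ?\<theta> = "theta E"
  have n: "?n > 0" by simp
  have \<theta>n: "?\<theta> \<le> ?n" by (rule theta_le_card[OF E])
  have \<theta>0: "0 \<le> ?\<theta>"
    using psd_quadform[OF Z(1), of 1] n by (simp add: eig ones_inner_self)
  obtain c where c: "c \<ge> 0" and c1: "c * (?n - ?\<theta>) \<le> ?\<theta>" and c2: "(k - 1) * c \<le> 1"
    and obj: "?\<theta> + (k - 1) * c * (?n - ?\<theta>) = min (k * ?\<theta>) ?n"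
  proof (cases "k * ?\<theta> \<le> ?n")
    case True
    show ?thesis
    proof (cases "?\<theta> = ?n")
      case True
      \<comment> \<open>Here \<open>c (n - \<theta>) \<le> \<theta>\<close> does not bound \<open>c\<close>, and any \<open>c \<ge> 0\<close> gives the same objective.\<close>
      with \<open>k * ?\<theta> \<le> ?n\<close> k n have "k = 1" by simp
      then show ?thesis using that[of 0] True by simp
    next
      case False
      then have d: "?n - ?\<theta> > 0" using \<theta>n by simp
      define c where "c = ?\<theta> / (?n - ?\<theta>)"
      have cd: "c * (?n - ?\<theta>) = ?\<theta>" using d by (simp add: c_def)
      have "(k - 1) * c \<le> 1" using True d by (simp add: c_def field_simps)
      moreover have "?\<theta> + (k - 1) * c * (?n - ?\<theta>) = k * ?\<theta>"
        unfolding mult.assoc cd by (simp add: algebra_simps)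
      ultimately show ?thesis using that[of c] cd True d \<theta>0 by (simp add: c_def)
    qed
  next
    case False
    then have k1: "k > 1" using \<theta>n k by (cases "k = 1") auto
    have "?n - ?\<theta> \<le> ?\<theta> * (k - 1)" using False by (simp add: algebra_simps)
    then show ?thesis using that[of "1 / (k - 1)"] k1 False by (simp add: divide_le_eq)
  qed
  let ?X = "(1 / k) *\<^sub>R Z" and ?Y = "(c / k) *\<^sub>R ((1 / ?n) *\<^sub>R all_ones - Z)"
  have k0: "k > 0" using k by simp
  have symZ: "transpose Z = Z" by (rule psd_symmetric[OF Z(1)])
  have symX: "transpose ?X = ?X" and symY: "transpose ?Y = ?Y"
    using symZ by (auto simp: symmetric_iff all_ones_def)
  have quadX: "x \<bullet> (?X *v x) = (x \<bullet> (Z *v x)) / k" for x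
    by (simp add: scaleR_matrix_vector_assoc[symmetric])
  have quadY: "x \<bullet> (?Y *v x) = c / k * ((x \<bullet> 1)\<^sup>2 / ?n - x \<bullet> (Z *v x))" for x
    by (simp add: matrix_vector_mult_diff_rdistrib inner_diff_right quadform_all_ones
        scaleR_matrix_vector_assoc[symmetric])
  have "psd (?X - ?Y)"
  proof (rule psdI)
    show "transpose (?X - ?Y) = ?X - ?Y"
      using symZ by (auto simp: symmetric_iff all_ones_def)
    fix x
    define q where "q = x \<bullet> (Z *v x)"
    define s where "s = (x \<bullet> 1)\<^sup>2 / ?n"
    have s: "s \<ge> 0" using n by (simp add: s_def)
    have "?\<theta> / ?n * (x \<bullet> 1)\<^sup>2 / ?n \<le> q"
      unfolding q_def by (rule quadform_ge_ones_eigenvalue[OF Z(1) eig])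
    then have "?\<theta> / ?n * s \<le> q" by (simp add: s_def)
    then have "(1 + c) * (?\<theta> / ?n * s) \<le> (1 + c) * q" using c by (intro mult_left_mono) auto
    moreover have "c * s \<le> (1 + c) * (?\<theta> / ?n * s)"
    proof -
      have "c * ?n \<le> (1 + c) * ?\<theta>" using c1 by (simp add: algebra_simps)
      then have "c \<le> (1 + c) * ?\<theta> / ?n" using n by (simp add: pos_le_divide_eq)
      then have "c * s \<le> (1 + c) * ?\<theta> / ?n * s" using s by (rule mult_right_mono)
      then show ?thesis by simp
    qed
    ultimately have "0 \<le> ((1 + c) * q - c * s) / k" using k0 by simp
    also have "\<dots> = x \<bullet> ((?X - ?Y) *v x)"
      unfolding matrix_vector_mult_diff_rdistrib inner_diff_right quadX quadY
        q_def[symmetric] s_def[symmetric] using k0 by (simp add: field_simps)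
    finally show "0 \<le> x \<bullet> ((?X - ?Y) *v x)" .
  qed
  moreover have "psd (?X + (k - 1) *\<^sub>R ?Y)"
  proof (rule psdI)
    show "transpose (?X + (k - 1) *\<^sub>R ?Y) = ?X + (k - 1) *\<^sub>R ?Y"
      using symZ by (auto simp: symmetric_iff all_ones_def)
    fix x
    define q where "q = x \<bullet> (Z *v x)"
    define s where "s = (x \<bullet> 1)\<^sup>2 / ?n"
    have "s \<ge> 0" using n by (simp add: s_def)
    moreover have "q \<ge> 0" unfolding q_def by (rule psd_quadform[OF Z(1)])
    ultimately have "0 \<le> ((1 - (k - 1) * c) * q + ((k - 1) * c) * s) / k"
      using k c c2 by (intro divide_nonneg_pos add_nonneg_nonneg mult_nonneg_nonneg) auto
    also have "\<dots> = x \<bullet> ((?X + (k - 1) *\<^sub>R ?Y) *v x)"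
      unfolding matrix_vector_mult_add_rdistrib scaleR_matrix_vector_assoc[symmetric, of "k - 1"]
        inner_add_right inner_scaleR_right quadX quadY q_def[symmetric] s_def[symmetric]
      using k0 by (simp add: field_simps)
    finally show "0 \<le> x \<bullet> ((?X + (k - 1) *\<^sub>R ?Y) *v x)" .
  qed
  moreover have "schur (adj_matrix E) ?X = 0" using Z(2) by (auto simp: schur_eq_0_iff)
  moreover have "schur (mat 1) ?Y = 0" by (auto simp: schur_eq_0_iff mat_def all_ones_def Z(3))
  moreover have "k * trace ?X = 1" using k0 n by (simp add: trace_def Z(3))
  ultimately have feas: "(?X, ?Y) \<in> theta_cart_feasible E k"
    using symX symY by (simp add: theta_cart_feasible_def loewner_le_def minner_mat1)
  have "theta_cart_objective k ?X ?Y \<le> theta_cart_complete E k"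
    using theta_cart_complete_attained[OF E k(1)] feas by metis
  moreover have "theta_cart_objective k ?X ?Y = ?\<theta> + (k - 1) * c * (?n - ?\<theta>)"
    unfolding theta_cart_objective_def minner_all_ones quadX quadY
    using k0 n by (simp add: eig ones_inner_self power2_eq_square)
  ultimately show ?thesis using obj by simp
qed

theorem theorem5:
  fixes E :: "'v::finite \<Rightarrow> 'v \<Rightarrow> bool" and k :: real
  assumes "simple_graph E"
    and "\<exists>\<A>. partially_coherent_algebra (adj_matrix E) \<A> \<and> homogeneous \<A>"
    and "1 \<le> k" and "k \<le> real CARD('v)"
  shows "theta_cart_complete E k = min (k * theta E) (real CARD('v)) \<and>
         min (k * theta E) (real CARD('v)) = theta_k E k"
proof -
  obtain Z where Z: "psd Z" "schur (adj_matrix E) Z = 0" "\<And>i. Z $ i $ i = 1 / real CARD('v)"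
    "Z *v 1 = (theta E / real CARD('v)) *\<^sub>R 1"
    using assms(2) homogeneous_theta_optimum[OF assms(1)] by metis
  show ?thesis
    using theta_cart_complete_le[OF assms(1,3)] theta_cart_complete_ge[OF assms(1,3) Z]
      theta_k_le[OF assms(1,3,4)] theta_k_ge[OF assms(1,3,4) Z]
    by (intro conjI order_antisym)
qed

end
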